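(* Let $d\ge 1$, $1\le m\le d$, $y\in\{+1,-1\}$, let $e_1,\dots,e_d$ be the principal components (an orthonormal basis of $\mathbb{R}^d$), let $z=\sum_{i=1}^d\alpha_i e_i\in\mathbb{R}^d$ be a representation with label $y$, let $\Delta q=\sum_{i=1}^d\gamma_i e_i$ be the learned decision boundary vector, and let $\Delta p=\sum_{i=1}^d\eta_i\gamma_i e_i$ be the causal decision boundary vector, which classifies $z$ correctly, i.e. $y\,(z\cdot\Delta p)>0$. Let $\hat z=z-\sum_{i=1}^m(z\cdot e_i)e_i$ be the trimmed representation. If any one of the following conditions holds: $$\text{(a)}\ \ y\sum_{i=1}^m\eta_i\alpha_i\gamma_i=0,\qquad \text{(b)}\ \ y\sum_{i=1}^m\eta_i\alpha_i\gamma_i<0,\qquad \text{(c)}\ \ 0<y\sum_{i=1}^m\eta_i\alpha_i\gamma_i<y\sum_{i=1}^d\eta_i\alpha_i\gamma_i,$$ then $\hat z$ preserves the correct prediction under the causal decision boundary, i.e. $y\,(\hat z\cdot\Delta p)>0$.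
   Context: Setting: binary classification with labels in $\{+1,-1\}$ and representations in $\mathbb{R}^d$, with no bias term. The classifier has learned prototypes $q_{+1},q_{-1}\in\mathbb{R}^d$, with learned decision boundary vector $\Delta q=q_{+1}-q_{-1}$. It is assumed that there exist causal prototypes $p_{+1},p_{-1}\in\mathbb{R}^d$ that always make correct predictions on the learned representations; the causal decision boundary vector is $\Delta p=p_{+1}-p_{-1}$. A representation $z$ with label $y$ is classified correctly by a decision boundary vector $v$ if $y\,(z\cdot v)>0$. Principal components: given $z$ and representations $\tilde z_1,\dots,\tilde z_n\in\mathbb{R}^d$ of augmented variants of the same sample, let $\mathbf{Z}$ be the matrix with rows $z,\tilde z_1,\dots,\tilde z_n$ and $\bar{\mathbf{Z}}$ the matrix of the same size all of whose rows are the mean of these $n+1$ vectors. Then $e_1,\dots,e_d$ are orthonormal eigenvectors of $(\mathbf{Z}-\bar{\mathbf{Z}})^\top(\mathbf{Z}-\bar{\mathbf{Z}})$, ordered by non-increasing eigenvalue; they form an orthonormal basis of $\mathbb{R}^d$. Write $\alpha_i=z\cdot e_i$, $\gamma_i=\Delta q\cdot e_i$; the coordinates of $\Delta p$ are written $\Delta p\cdot e_i=\eta_i\gamma_i$ with real numbers $\eta_i$ (so $\Delta p$ is viewed as a coordinatewise rescaling of $\Delta q$). *)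

theory Defs
  imports "HOL-Analysis.Analysis"
begin

text \<open>A label is a real number in {1, -1}; there is no bias term.\<close>

definition classifies_correctly :: "real ^ 'd \<Rightarrow> real \<Rightarrow> real ^ 'd \<Rightarrow> bool" where
  "classifies_correctly v y z \<longleftrightarrow> y * (z \<bullet> v) > 0"

definition mean_matrix :: "real ^ 'd ^ 'k \<Rightarrow> real ^ 'd ^ 'k" where
  "mean_matrix Z = (\<chi> k. (1 / real CARD('k)) *\<^sub>R (\<Sum>j\<in>UNIV. row j Z))"

text \<open>The components are indexed by the natural numbers 1, ..., \<open>CARD('d)\<close>, because their order
  matters; values of \<open>e\<close> and \<open>l\<close> at other indices are irrelevant. Being \<open>CARD('d)\<close> many
  orthonormal vectors, they form a basis.\<close>

definition principal_components :: "real ^ 'd ^ 'k \<Rightarrow> (nat \<Rightarrow> real ^ 'd) \<Rightarrow> bool" where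
  "principal_components Z e \<longleftrightarrow>
     (\<forall>i\<in>{1..CARD('d)}. \<forall>j\<in>{1..CARD('d)}. e i \<bullet> e j = (if i = j then 1 else 0)) \<and>
     (\<exists>l :: nat \<Rightarrow> real.
        (\<forall>i\<in>{1..CARD('d)}.
           (transpose (Z - mean_matrix Z) ** (Z - mean_matrix Z)) *v e i = l i *\<^sub>R e i) \<and>
        (\<forall>i\<in>{1..CARD('d)}. \<forall>j\<in>{1..CARD('d)}. i \<le> j \<longrightarrow> l j \<le> l i))"

definition trimmed :: "(nat \<Rightarrow> real ^ 'd) \<Rightarrow> nat \<Rightarrow> real ^ 'd \<Rightarrow> real ^ 'd" where
  "trimmed e m z = z - (\<Sum>i=1..m. (z \<bullet> e i) *\<^sub>R e i)"

end

theory Submission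
  imports Defs
begin

text \<open>In an orthonormal basis the inner product is computed coordinatewise, so
  \<open>z \<bullet> \<Delta>p\<close> is the sum of all \<eta>_i \<alpha>_i \<gamma>_i, and
  trimming removes exactly the first m summands. Write T for y times the full sum and S for y times
  the removed part; the new margin is T - S, and T > 0 by hypothesis. In cases (a) and (b), S \<le>
  0 gives T - S \<ge> T > 0; case (c) contains S < T. The lemma \<open>inner_sum_orthonormal\<close>
  reads coordinates off an expansion, for both \<open>z\<close> and
  \<open>\<Delta>p\<close>.\<close>

lemma inner_sum_orthonormal:
  fixes e :: "'i \<Rightarrow> 'a :: real_inner"
  assumes "finite I" and "j \<in> I"
    and "\<And>i. i \<in> I \<Longrightarrow> e i \<bullet> e j = (if i = j then 1 else 0)"
  shows "(\<Sum>i\<in>I. c i *\<^sub>R e i) \<bullet> e j = c j"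
proof -
  have "(\<Sum>i\<in>I. c i *\<^sub>R e i) \<bullet> e j = (\<Sum>i\<in>I. if i = j then c i else 0)"
    unfolding inner_sum_left using assms(3) by (intro sum.cong) auto
  then show ?thesis
    using assms(1,2) by simp
qed

theorem proposition2:
  fixes Z :: "real ^ 'd ^ 'k" and k0 :: 'k
    and e :: "nat \<Rightarrow> real ^ 'd"
    and z \<Delta>q \<Delta>p q_pos q_neg p_pos p_neg :: "real ^ 'd"
    and y :: real
    and \<alpha> \<gamma> \<eta> :: "nat \<Rightarrow> real"
    and m :: nat
  assumes "1 \<le> m" and "m \<le> CARD('d)"
    and "y \<in> {1, -1}"
    and "row k0 Z = z"
    and "principal_components Z e"
    and "\<Delta>q = q_pos - q_neg"
    and "\<Delta>p = p_pos - p_neg"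
    and "z = (\<Sum>i=1..CARD('d). \<alpha> i *\<^sub>R e i)"
    and "\<Delta>q = (\<Sum>i=1..CARD('d). \<gamma> i *\<^sub>R e i)"
    and "\<Delta>p = (\<Sum>i=1..CARD('d). (\<eta> i * \<gamma> i) *\<^sub>R e i)"
    and "classifies_correctly \<Delta>p y z"
    and "y * (\<Sum>i=1..m. \<eta> i * \<alpha> i * \<gamma> i) = 0
       \<or> y * (\<Sum>i=1..m. \<eta> i * \<alpha> i * \<gamma> i) < 0
       \<or> (0 < y * (\<Sum>i=1..m. \<eta> i * \<alpha> i * \<gamma> i) \<and>
          y * (\<Sum>i=1..m. \<eta> i * \<alpha> i * \<gamma> i)
            < y * (\<Sum>i=1..CARD('d). \<eta> i * \<alpha> i * \<gamma> i))"
  shows "classifies_correctly \<Delta>p y (trimmed e m z)"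
proof -
  have orth: "e i \<bullet> e j = (if i = j then 1 else 0)"
    if "i \<in> {1..CARD('d)}" "j \<in> {1..CARD('d)}" for i j
    using assms(5) that unfolding principal_components_def by blast
  have \<alpha>: "z \<bullet> e i = \<alpha> i" if "i \<in> {1..CARD('d)}" for i
    unfolding assms(8) using orth that by (intro inner_sum_orthonormal) auto
  \<comment> \<open>The basis vector stands on the left because \<open>inner_sum_left\<close>
    produces this form in \<open>partial\<close>.\<close>
  have \<eta>\<gamma>: "e i \<bullet> \<Delta>p = \<eta> i * \<gamma> i" if "i \<in> {1..CARD('d)}" for i
    unfolding assms(10) inner_commute[of "e i"]
    using orth that by (intro inner_sum_orthonormal) auto
  \<comment> \<open>Kept general in \<open>n\<close>: \<open>n = m\<close> gives the part that
    trimming removes, \<open>n = CARD('d)\<close> the whole margin.\<close>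
  have partial: "(\<Sum>i=1..n. (z \<bullet> e i) *\<^sub>R e i) \<bullet> \<Delta>p = (\<Sum>i=1..n. \<eta> i * \<alpha> i * \<gamma> i)"
    if "n \<le> CARD('d)" for n
    unfolding inner_sum_left using that \<alpha> \<eta>\<gamma> by (intro sum.cong) auto
  \<comment> \<open>The expansion of \<open>z\<close> is rewritten with its own inner products as
    coefficients, the shape that \<open>partial\<close> and \<open>trimmed\<close> share.\<close>
  have "z = (\<Sum>i=1..CARD('d). (z \<bullet> e i) *\<^sub>R e i)"
    using assms(8) \<alpha> by simp
  then have "z \<bullet> \<Delta>p = (\<Sum>i=1..CARD('d). \<eta> i * \<alpha> i * \<gamma> i)"
    using partial[of "CARD('d)"] by simp
  moreover have "trimmed e m z \<bullet> \<Delta>p = z \<bullet> \<Delta>p - (\<Sum>i=1..m. \<eta> i * \<alpha> i * \<gamma> i)"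
    unfolding trimmed_def inner_diff_left using partial[OF assms(2)] by simp
  \<comment> \<open>After distributing \<open>y\<close>, the goal is T - S > 0, which is linear
    arithmetic in each of the three cases.\<close>
  ultimately show ?thesis
    using assms(11,12) unfolding classifies_correctly_def by (auto simp: right_diff_distrib)
qed

end
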